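(* Let $t>0$ be fixed, let $\{x(u,s),u\in\mathbb{R},s\ge0\}$ be an Arratia flow, and let $T_t$ be the random operator in $L_2(\mathbb{R})$ given by $(T_tf)(u)=f(x(u,t))$, $u\in\mathbb{R}$; write $T_t^\omega$ for its realization at the elementary event $\omega$. Let $$K=\left\{f\in W_2^1(\mathbb{R})\;\Big|\;\int_{\mathbb{R}}f^2(u)(1+|u|)^3du+\int_{\mathbb{R}}\left(f'(u)\right)^2(1+|u|)^7du\le1\right\}.$$ There exists a set $\widetilde{\Omega}$ of probability one such that for any $\omega\in\widetilde{\Omega}$ and $n\in\mathbb{N}$ $$d_n\left(T_t^{\omega}(K)\right)\le\frac{C(\omega)}{n^{\frac{3}{10}}},$$ where the constant $C(\omega)>0$ does not depend on $n$, and $d_n$ denotes the Kolmogorov $n$-width in $L_2(\mathbb{R})$.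
   Context: An Arratia flow is a family of real random processes $\{x(u,s),u\in\mathbb{R},s\ge0\}$ such that: (1) for each $u\in\mathbb{R}$, $x(u,\cdot)$ is a Wiener process with respect to the joint filtration with $x(u,0)=u$; (2) for any $u_1\le u_2$ and $s\ge0$, $x(u_1,s)\le x(u_2,s)$ a.s.; (3) the joint characteristics are $d\langle x(u_1,\cdot),x(u_2,\cdot)\rangle(s)=\mathbf 1_{\{x(u_1,s)=x(u_2,s)\}}ds$. A modification right-continuous in $u$ is used, for which $x(\cdot,s)$ is a nondecreasing right-continuous step function for every $s>0$. $W_2^1(\mathbb{R})$ is the Sobolev space of real functions in $L_2(\mathbb{R})$ with weak derivative in $L_2(\mathbb{R})$; its elements are identified with their continuous representatives, so that $T_t^\omega(K)=\{f(x(\cdot,t,\omega)):f\in K\}$. The Kolmogorov $n$-width of a set $C\subseteq H$ in a Hilbert space $H$ is $$d_n(C)=\inf_{\dim L\le n}\,\sup_{f\in C}\,\inf_{g\in L}\|f-g\|_H,$$ where the first infimum is over linear subspaces $L$ of $H$ of dimension at most $n$. Here $\mathbb{N}=\{1,2,\dots\}$. *)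

theory Defs
  imports "HOL-Probability.Probability"
begin

section \<open>The Hilbert space \<open>L\<^sub>2(\<real>)\<close>\<close>

definition L2_functions :: "(real \<Rightarrow> real) set" where
  "L2_functions = {f. f \<in> borel_measurable lborel \<and> integrable lborel (\<lambda>u. (f u)\<^sup>2)}"

lemma L2_functions_zero: "(\<lambda>u. 0) \<in> L2_functions"
  by (simp add: L2_functions_def)

lemma L2_functions_mult_integrable:
  assumes f: "f \<in> L2_functions" and g: "g \<in> L2_functions"
  shows "integrable lborel (\<lambda>u. f u * g u)"
proof (rule Bochner_Integration.integrable_bound[of _ "\<lambda>u. (f u)\<^sup>2 + (g u)\<^sup>2"])
  show "integrable lborel (\<lambda>u. (f u)\<^sup>2 + (g u)\<^sup>2)"
    using f g by (simp add: L2_functions_def)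
  show "(\<lambda>u. f u * g u) \<in> borel_measurable lborel"
    using f g by (auto simp: L2_functions_def)
  have "\<bar>a * b\<bar> \<le> a\<^sup>2 + b\<^sup>2" for a b :: real
  proof -
    have "2 * (\<bar>a\<bar> * \<bar>b\<bar>) \<le> a\<^sup>2 + b\<^sup>2"
      using sum_squares_bound[of "\<bar>a\<bar>" "\<bar>b\<bar>"] by simp
    moreover have "0 \<le> \<bar>a\<bar> * \<bar>b\<bar>" by simp
    ultimately show ?thesis unfolding abs_mult by linarith
  qed
  then show "AE u in lborel. norm (f u * g u) \<le> norm ((f u)\<^sup>2 + (g u)\<^sup>2)"
    by simp
qed

lemma L2_functions_add:
  assumes f: "f \<in> L2_functions" and g: "g \<in> L2_functions"
  shows "(\<lambda>u. f u + g u) \<in> L2_functions"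
proof -
  have "integrable lborel (\<lambda>u. (f u)\<^sup>2 + (g u)\<^sup>2 + 2 * (f u * g u))"
    using f g L2_functions_mult_integrable[OF f g]
    by (intro Bochner_Integration.integrable_add integrable_mult_right)
       (simp_all add: L2_functions_def)
  moreover have "(\<lambda>u. (f u)\<^sup>2 + (g u)\<^sup>2 + 2 * (f u * g u)) = (\<lambda>u. (f u + g u)\<^sup>2)"
    by (simp add: power2_sum fun_eq_iff)
  ultimately show ?thesis
    using f g by (auto simp: L2_functions_def)
qed

lemma L2_functions_scale:
  assumes "f \<in> L2_functions" shows "(\<lambda>u. c * f u) \<in> L2_functions"
  using assms by (auto simp: L2_functions_def power_mult_distrib)

definition L2_rel :: "(real \<Rightarrow> real) \<Rightarrow> (real \<Rightarrow> real) \<Rightarrow> bool" where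
  "L2_rel f g \<longleftrightarrow> f \<in> L2_functions \<and> g \<in> L2_functions \<and> (AE u in lborel. f u = g u)"

quotient_type L2 = "real \<Rightarrow> real" / partial: L2_rel
proof (rule part_equivpI)
  show "\<exists>f. L2_rel f f"
    using L2_functions_zero by (auto simp: L2_rel_def)
  show "symp L2_rel"
    by (auto simp: symp_def L2_rel_def)
  show "transp L2_rel"
    by (auto simp: transp_def L2_rel_def)
qed

instantiation L2 :: real_inner
begin

lift_definition zero_L2 :: L2 is "\<lambda>u. 0"
  by (simp add: L2_rel_def L2_functions_zero)

lift_definition plus_L2 :: "L2 \<Rightarrow> L2 \<Rightarrow> L2" is "\<lambda>f g u. f u + g u"
  by (auto simp: L2_rel_def intro: L2_functions_add)

lift_definition scaleR_L2 :: "real \<Rightarrow> L2 \<Rightarrow> L2" is "\<lambda>c f u. c * f u"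
  by (auto simp: L2_rel_def intro: L2_functions_scale)

lift_definition uminus_L2 :: "L2 \<Rightarrow> L2" is "\<lambda>f u. - f u"
  using L2_functions_scale[of _ "- 1"] by (auto simp: L2_rel_def)

lift_definition inner_L2 :: "L2 \<Rightarrow> L2 \<Rightarrow> real" is "\<lambda>f g. \<integral>u. f u * g u \<partial>lborel"
  by (rule integral_cong_AE) (auto simp: L2_rel_def L2_functions_def)

definition minus_L2 :: "L2 \<Rightarrow> L2 \<Rightarrow> L2" where
  "f - g = f + - g" for f g :: L2

definition norm_L2 :: "L2 \<Rightarrow> real" where
  "norm f = sqrt (inner f f)" for f :: L2

definition sgn_L2 :: "L2 \<Rightarrow> L2" where
  "sgn f = scaleR (inverse (norm f)) f" for f :: L2

definition dist_L2 :: "L2 \<Rightarrow> L2 \<Rightarrow> real" where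
  "dist f g = norm (f - g)" for f g :: L2

definition uniformity_L2 :: "(L2 \<times> L2) filter" where
  "uniformity_L2 = (INF e\<in>{0<..}. principal {(f, g). dist f g < e})"

definition open_L2 :: "L2 set \<Rightarrow> bool" where
  "open_L2 U \<longleftrightarrow> (\<forall>f\<in>U. eventually (\<lambda>(f', g). f' = f \<longrightarrow> g \<in> U) uniformity)"

instance
proof
  fix f g h :: L2 and a b :: real and U :: "L2 set"
  show "f + g + h = f + (g + h)"
    by transfer (auto simp: L2_rel_def add.assoc intro!: L2_functions_add)
  show "f + g = g + f"
    by transfer (auto simp: L2_rel_def add.commute intro!: L2_functions_add)
  show "0 + f = f"
    by transfer (auto simp: L2_rel_def)
  show "- f + f = 0"
    by transfer (auto simp: L2_rel_def L2_functions_zero)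
  show "f - g = f + - g"
    by (rule minus_L2_def)
  show "a *\<^sub>R (f + g) = a *\<^sub>R f + a *\<^sub>R g"
    by transfer (auto simp: L2_rel_def distrib_left intro!: L2_functions_add L2_functions_scale)
  show "(a + b) *\<^sub>R f = a *\<^sub>R f + b *\<^sub>R f"
    by transfer (auto simp: L2_rel_def distrib_right intro!: L2_functions_add L2_functions_scale)
  show "a *\<^sub>R b *\<^sub>R f = (a * b) *\<^sub>R f"
    by transfer (auto simp: L2_rel_def mult.assoc intro!: L2_functions_scale)
  show "1 *\<^sub>R f = f"
    by transfer (auto simp: L2_rel_def)
  show "sgn f = scaleR (inverse (norm f)) f" "dist f g = norm (f - g)"
    by (simp_all add: sgn_L2_def dist_L2_def)
  show "(uniformity :: (L2 \<times> L2) filter) = (INF e\<in>{0<..}. principal {(f, g). dist f g < e})"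
    by (rule uniformity_L2_def)
  show "open U \<longleftrightarrow> (\<forall>f\<in>U. eventually (\<lambda>(f', g). f' = f \<longrightarrow> g \<in> U) uniformity)"
    by (rule open_L2_def)
  show "inner f g = inner g f"
    by transfer (simp add: mult.commute)
  show "inner (f + g) h = inner f h + inner g h"
    by transfer
       (simp add: L2_rel_def distrib_right L2_functions_mult_integrable)
  show "inner (a *\<^sub>R f) g = a * inner f g"
    by transfer (simp add: mult.assoc)
  show "0 \<le> inner f f"
    by transfer simp
  show "inner f f = 0 \<longleftrightarrow> f = 0"
  proof transfer
    fix f :: "real \<Rightarrow> real"
    assume "L2_rel f f"
    then have f: "f \<in> L2_functions" by (simp add: L2_rel_def)
    have "(\<integral>u. f u * f u \<partial>lborel) = 0 \<longleftrightarrow> (AE u in lborel. f u * f u = 0)"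
      by (rule integral_nonneg_eq_0_iff_AE) (auto intro: L2_functions_mult_integrable f)
    then show "(\<integral>u. f u * f u \<partial>lborel) = 0 \<longleftrightarrow> L2_rel f (\<lambda>u. 0)"
      using f by (simp add: L2_rel_def L2_functions_zero)
  qed
  show "norm f = sqrt (inner f f)"
    by (rule norm_L2_def)
qed

end

text \<open>The class of a square integrable function; \<open>to_L2 f\<close> is meaningful only for
  \<open>f \<in> L2_functions\<close>.\<close>

definition to_L2 :: "(real \<Rightarrow> real) \<Rightarrow> L2" where
  "to_L2 = abs_L2"


section \<open>Kolmogorov widths\<close>

text \<open>Values are in \<^typ>\<open>ennreal\<close>, so that the width of an unbounded set is well defined. Since
  \<^const>\<open>dim\<close> is 0 on infinite-dimensional spaces, finite dimension is required separately.\<close>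

definition kolmogorov_width :: "nat \<Rightarrow> 'a::real_inner set \<Rightarrow> ennreal" where
  "kolmogorov_width n C =
     (INF L\<in>{L. subspace L \<and> (\<exists>B. finite B \<and> span B = L) \<and> dim L \<le> n}.
        SUP f\<in>C. INF g\<in>L. ennreal (norm (f - g)))"


section \<open>The Sobolev space \<open>W\<^sub>2\<^sup>1(\<real>)\<close>\<close>

definition test_function :: "(real \<Rightarrow> real) \<Rightarrow> bool" where
  "test_function \<phi> \<longleftrightarrow>
     (\<forall>k u. ((deriv ^^ k) \<phi>) differentiable (at u)) \<and> (\<exists>R. \<forall>u. \<bar>u\<bar> > R \<longrightarrow> \<phi> u = 0)"

definition has_weak_derivative :: "(real \<Rightarrow> real) \<Rightarrow> (real \<Rightarrow> real) \<Rightarrow> bool" where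
  "has_weak_derivative f g \<longleftrightarrow>
     (\<forall>a b. set_integrable lborel {a..b} f \<and> set_integrable lborel {a..b} g) \<and>
     (\<forall>\<phi>. test_function \<phi> \<longrightarrow>
        (\<integral>u. f u * deriv \<phi> u \<partial>lborel) = - (\<integral>u. g u * \<phi> u \<partial>lborel))"

text \<open>Elements of \<open>W\<^sub>2\<^sup>1(\<real>)\<close> are given by their continuous representatives.\<close>

definition W21 :: "(real \<Rightarrow> real) set" where
  "W21 = {f. continuous_on UNIV f \<and> f \<in> L2_functions \<and>
             (\<exists>g\<in>L2_functions. has_weak_derivative f g)}"

definition K_set :: "(real \<Rightarrow> real) set" where
  "K_set = {f \<in> W21. \<exists>f'. has_weak_derivative f f' \<and>
     (\<integral>\<^sup>+u. ennreal ((f u)\<^sup>2 * (1 + \<bar>u\<bar>) ^ 3) \<partial>lborel)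
       + (\<integral>\<^sup>+u. ennreal ((f' u)\<^sup>2 * (1 + \<bar>u\<bar>) ^ 7) \<partial>lborel) \<le> 1}"


section \<open>Arratia flows\<close>

text \<open>Processes have time parameter in \<open>[0, \<infinity>)\<close>; values at negative times are irrelevant.\<close>

text \<open>\<open>\<F>\<^sub>s = \<sigma>(x(u, r), u \<in> \<real>, 0 \<le> r \<le> s)\<close>, augmented by the null sets.\<close>

definition joint_filtration ::
    "'w measure \<Rightarrow> (real \<Rightarrow> real \<Rightarrow> 'w \<Rightarrow> real) \<Rightarrow> real \<Rightarrow> 'w measure" where
  "joint_filtration M x s =
     sigma (space M)
       ({x u r -` B \<inter> space M | u r B. 0 \<le> r \<and> r \<le> s \<and> B \<in> sets borel} \<union> null_sets M)"

definition adapted :: "(real \<Rightarrow> 'w measure) \<Rightarrow> (real \<Rightarrow> 'w \<Rightarrow> real) \<Rightarrow> bool" where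
  "adapted F X \<longleftrightarrow> (\<forall>s\<ge>0. X s \<in> borel_measurable (F s))"

definition martingale ::
    "'w measure \<Rightarrow> (real \<Rightarrow> 'w measure) \<Rightarrow> (real \<Rightarrow> 'w \<Rightarrow> real) \<Rightarrow> bool" where
  "martingale M F X \<longleftrightarrow>
     adapted F X \<and> (\<forall>s\<ge>0. integrable M (X s)) \<and>
     (\<forall>r s. 0 \<le> r \<and> r \<le> s \<longrightarrow> (AE \<omega> in M. real_cond_exp M (F r) (X s) \<omega> = X r \<omega>))"

definition (in prob_space) wiener_process ::
    "(real \<Rightarrow> 'a measure) \<Rightarrow> real \<Rightarrow> (real \<Rightarrow> 'a \<Rightarrow> real) \<Rightarrow> bool" where
  "wiener_process F u W \<longleftrightarrow>
     adapted F W \<and>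
     (AE \<omega> in M. W 0 \<omega> = u) \<and>
     (AE \<omega> in M. continuous_on {0..} (\<lambda>s. W s \<omega>)) \<and>
     (\<forall>r s. 0 \<le> r \<and> r < s \<longrightarrow>
        distributed M lborel (\<lambda>\<omega>. W s \<omega> - W r \<omega>) (normal_density 0 (sqrt (s - r))) \<and>
        indep_set (sets (F r)) (sets (vimage_algebra (space M) (\<lambda>\<omega>. W s \<omega> - W r \<omega>) borel)))"

text \<open>The joint characteristic \<open>\<langle>X, Y\<rangle>\<close> of two continuous square integrable martingales: the
  continuous adapted process \<open>A\<close> of locally bounded variation with \<open>A(0) = 0\<close> for which
  \<open>X Y - A\<close> is a martingale; it is unique up to indistinguishability. Bounded variation is
  expressed by Jordan decomposition of the paths.\<close>

definition joint_characteristic ::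
    "'w measure \<Rightarrow> (real \<Rightarrow> 'w measure) \<Rightarrow> (real \<Rightarrow> 'w \<Rightarrow> real) \<Rightarrow> (real \<Rightarrow> 'w \<Rightarrow> real) \<Rightarrow>
     (real \<Rightarrow> 'w \<Rightarrow> real) \<Rightarrow> bool" where
  "joint_characteristic M F X Y A \<longleftrightarrow>
     adapted F A \<and>
     (AE \<omega> in M. A 0 \<omega> = 0 \<and> continuous_on {0..} (\<lambda>s. A s \<omega>) \<and>
        (\<exists>p q. mono_on {0..} p \<and> mono_on {0..} q \<and> (\<forall>s\<ge>0. A s \<omega> = p s - q s))) \<and>
     martingale M F (\<lambda>s \<omega>. X s \<omega> * Y s \<omega> - A s \<omega>)"

locale arratia_flow = prob_space M for M :: "'w measure" +
  fixes x :: "real \<Rightarrow> real \<Rightarrow> 'w \<Rightarrow> real"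
  assumes random_variable: "\<And>u s. 0 \<le> s \<Longrightarrow> x u s \<in> borel_measurable M"
    and wiener: "\<And>u. wiener_process (joint_filtration M x) u (x u)"
    and monotone: "\<And>u1 u2 s. u1 \<le> u2 \<Longrightarrow> 0 \<le> s \<Longrightarrow> AE \<omega> in M. x u1 s \<omega> \<le> x u2 s \<omega>"
    and characteristic: "\<And>u1 u2. \<exists>A.
          joint_characteristic M (joint_filtration M x) (x u1) (x u2) A \<and>
          (AE \<omega> in M. \<forall>s\<ge>0. A s \<omega> = (LBINT r:{0..s}. of_bool (x u1 r \<omega> = x u2 r \<omega>)))"

definition step_function :: "(real \<Rightarrow> real) \<Rightarrow> bool" where
  "step_function h \<longleftrightarrow> (\<forall>a b. finite (h ` {a..b}))"

text \<open>The modification of the flow that is right-continuous in the spatial variable. For monotone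
  right-continuous functions, \<^const>\<open>step_function\<close> means piecewise constant with
  finitely many jumps in every bounded interval.\<close>

locale right_continuous_arratia_flow = arratia_flow +
  assumes right_continuous_step: "\<And>s. 0 < s \<Longrightarrow> AE \<omega> in M.
      mono (\<lambda>u. x u s \<omega>) \<and> (\<forall>u. continuous (at_right u) (\<lambda>v. x v s \<omega>)) \<and>
      step_function (\<lambda>u. x u s \<omega>)"

definition flow_operator ::
    "(real \<Rightarrow> real \<Rightarrow> 'w \<Rightarrow> real) \<Rightarrow> real \<Rightarrow> 'w \<Rightarrow> (real \<Rightarrow> real) \<Rightarrow> (real \<Rightarrow> real)" where
  "flow_operator x t \<omega> f = (\<lambda>u. f (x u t \<omega>))"

end

theory Submission
  imports Defs
begin

text \<open>
  The flow grows linearly: by Borel--Cantelli along the integers and monotonicity, almost surely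
  \<open>\<bar>X u\<bar> \<le> C (1 + \<bar>u\<bar>)\<close> and \<open>1 + \<bar>u\<bar> \<le> C (1 + \<bar>X u\<bar>)\<close> for \<open>X u = x(u, t)\<close>. Every \<open>f \<in> K\<close> is
  Hoelder continuous of order one half and bounded by \<open>(1 + \<bar>y\<bar>)\<^sup>-\<^sup>3\<close>, because \<open>\<bar>f b - f a\<bar>\<close> is at
  most the integral of \<open>\<bar>f'\<bar>\<close> over \<open>[a, b]\<close> (test the weak derivative against a difference of
  two smooth ramps). So \<open>f \<circ> X\<close> is approximated, uniformly in \<open>f\<close>, by functions that vanish
  outside a window \<open>\<bar>u\<bar> \<le> U\<close> and inside it are constant on the preimages under \<open>X\<close> of \<open>n\<close> short
  intervals.
\<close>

section \<open>Smooth ramps\<close>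

text \<open>Under y = 1/x this is the decay that makes every \<open>flat_exp p\<close> flat at
  0.\<close>

lemma tendsto_poly_exp_minus_at_top:
  fixes p :: "real poly"
  shows "((\<lambda>y. poly p y * exp (- y)) \<longlongrightarrow> 0) at_top"
proof -
  have "((\<lambda>y. \<Sum>i\<le>degree p. coeff p i * (y ^ i / exp y)) \<longlongrightarrow> (\<Sum>i\<le>degree p. coeff p i * 0)) at_top"
    by (intro tendsto_intros tendsto_power_div_exp_0)
  moreover have "(\<lambda>y. \<Sum>i\<le>degree p. coeff p i * (y ^ i / exp y)) = (\<lambda>y. poly p y * exp (- y))"
    by (simp add: fun_eq_iff poly_altdef sum_distrib_right exp_minus divide_inverse mult.assoc)
  ultimately show ?thesis by simp
qed

text \<open>The classical function exp(-1/x), extended by 0, with a polynomial factor in 1/x. The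
  factor makes the family closed under differentiation, so smoothness needs only a formula for the
  first derivative.\<close>

definition flat_exp :: "real poly \<Rightarrow> real \<Rightarrow> real" where
  "flat_exp p x = (if x > 0 then poly p (1 / x) * exp (- (1 / x)) else 0)"

lemma flat_exp_minus: "flat_exp (- p) x = - flat_exp p x"
  by (simp add: flat_exp_def)

text \<open>With y = 1/x, the chain rule gives y^2 (p(y) - p'(y)) exp(-y) for x > 0, and
  \<open>[:0, 0, 1:]\<close> is the polynomial y^2. Only x = 0 calls for a limit.\<close>

lemma flat_exp_has_derivative:
  "(flat_exp p has_real_derivative flat_exp ([:0, 0, 1:] * (p - pderiv p)) x) (at x)"
proof -
  let ?q = "[:0, 0, 1:] * (p - pderiv p)"
  have poly_q: "poly ?q y = y\<^sup>2 * (poly p y - poly (pderiv p) y)" for y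
    by (simp add: power2_eq_square)
  consider "x > 0" | "x < 0" | "x = 0" by linarith
  then show ?thesis
  proof cases
    case 1
    have *: "((\<lambda>x. 1 / x) has_real_derivative - ((1 / x)\<^sup>2)) (at x)"
      using 1 by (auto intro!: derivative_eq_intros simp: power2_eq_square)
    have "((\<lambda>x. poly p (1 / x) * exp (- (1 / x))) has_real_derivative
        poly (pderiv p) (1 / x) * (- ((1 / x)\<^sup>2)) * exp (- (1 / x))
        + exp (- (1 / x)) * - (- ((1 / x)\<^sup>2)) * poly p (1 / x)) (at x)"
      using DERIV_mult[OF DERIV_chain2[OF poly_DERIV *] DERIV_chain2[OF DERIV_exp DERIV_minus[OF *]]] .
    then have "((\<lambda>x. poly p (1 / x) * exp (- (1 / x))) has_real_derivative
        flat_exp ?q x) (at x)"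
      by (rule DERIV_cong) (simp only: flat_exp_def 1 if_True poly_q, algebra)
    then show ?thesis
      by (rule has_field_derivative_transform_within_open[of _ _ _ "{0<..}"])
        (use 1 in \<open>auto simp: flat_exp_def\<close>)
  next
    case 2
    have "((\<lambda>x. 0) has_real_derivative flat_exp ?q x) (at x)"
      using 2 by (simp add: flat_exp_def)
    then show ?thesis
      by (rule has_field_derivative_transform_within_open[of _ _ _ "{..<0}"])
        (use 2 in \<open>auto simp: flat_exp_def\<close>)
  next
    case 3
    \<comment> \<open>Substituting h = 1/y turns the difference quotient into y p(y) exp(-y), again
      a polynomial, \<open>pCons 0 p\<close>, times a decaying exponential.\<close>
    have "((\<lambda>h. flat_exp p h / h) \<longlongrightarrow> 0) (at_right 0)"
      unfolding filterlim_at_right_to_top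
    proof (rule Lim_transform_eventually[OF tendsto_poly_exp_minus_at_top[of "pCons 0 p"]])
      show "\<forall>\<^sub>F y in at_top. poly (pCons 0 p) y * exp (- y) = flat_exp p (inverse y) / inverse y"
        using eventually_gt_at_top[of 0]
        by eventually_elim (simp add: flat_exp_def field_simps)
    qed
    moreover have "((\<lambda>h. flat_exp p h / h) \<longlongrightarrow> 0) (at_left 0)"
      by (rule tendsto_eventually) (auto simp: flat_exp_def eventually_at_filter)
    ultimately have "((\<lambda>h. flat_exp p h / h) \<longlongrightarrow> 0) (at 0)"
      by (simp add: filterlim_split_at)
    then show ?thesis
      using 3 by (simp add: DERIV_def flat_exp_def)
  qed
qed

text \<open>Each product vanishes outside the open interval from \<open>a\<close> to
  \<open>b\<close>. Sums are included because the product rule creates them; scalar factors are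
  absorbed by the polynomials.\<close>

inductive_set flat_span :: "(real \<Rightarrow> real) set" where
  prod: "(\<lambda>x. flat_exp p (x - a) * flat_exp q (b - x)) \<in> flat_span"
| add: "f \<in> flat_span \<Longrightarrow> g \<in> flat_span \<Longrightarrow> (\<lambda>x. f x + g x) \<in> flat_span"

lemma flat_span_has_derivative:
  assumes "f \<in> flat_span"
  shows "\<exists>f'\<in>flat_span. \<forall>x. (f has_real_derivative f' x) (at x)"
  using assms
proof induction
  case (prod p a q b)
  let ?d = "\<lambda>p. [:0, 0, 1:] * (p - pderiv p)"
  \<comment> \<open>The inner derivative -1 of b - x is moved into the polynomial, so that the
    second summand is again of product form.\<close>
  let ?f' = "\<lambda>x. flat_exp (?d p) (x - a) * flat_exp q (b - x)
    + flat_exp p (x - a) * flat_exp (- ?d q) (b - x)"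
  have "((\<lambda>x. flat_exp p (x - a) * flat_exp q (b - x)) has_real_derivative ?f' x) (at x)" for x
    by (rule derivative_eq_intros DERIV_chain2[OF flat_exp_has_derivative] refl)+
       (simp only: flat_exp_minus, simp)
  moreover have "?f' \<in> flat_span"
    by (intro flat_span.intros)
  ultimately show ?case
    by (intro bexI[of _ ?f'] allI)
next
  case (add f g)
  then obtain f' g' where "f' \<in> flat_span" "\<forall>x. (f has_real_derivative f' x) (at x)"
    "g' \<in> flat_span" "\<forall>x. (g has_real_derivative g' x) (at x)"
    by blast
  then show ?case
    by (intro bexI[of _ "\<lambda>x. f' x + g' x"] allI DERIV_add flat_span.add) auto
qed

lemma flat_span_iterated_deriv:
  assumes "f \<in> flat_span"
  shows "(deriv ^^ k) f \<in> flat_span"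
proof (induction k)
  case (Suc k)
  then obtain f' where "f' \<in> flat_span" "\<forall>x. ((deriv ^^ k) f has_real_derivative f' x) (at x)"
    using flat_span_has_derivative by blast
  moreover from this have "deriv ((deriv ^^ k) f) = f'"
    by (auto simp: fun_eq_iff intro: DERIV_imp_deriv)
  ultimately show ?case by simp
qed (use assms in simp)

lemma flat_span_differentiable:
  "f \<in> flat_span \<Longrightarrow> f differentiable (at x)"
  using flat_span_has_derivative real_differentiable_def by blast

lemma flat_span_isCont:
  "f \<in> flat_span \<Longrightarrow> isCont f x"
  by (intro differentiable_imp_continuous_within flat_span_differentiable)

text \<open>Only the derivative is asked to lie in \<open>flat_span\<close>: a ramp is a primitive
  of a bump and has no evident product form, but its derivatives of order at least one are iterated
  derivatives of \<psi>.\<close>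

lemma test_function_primitive:
  assumes "\<psi> \<in> flat_span" "\<And>x. (\<phi> has_real_derivative \<psi> x) (at x)"
    and "\<And>u. \<bar>u\<bar> > R \<Longrightarrow> \<phi> u = 0"
  shows "test_function \<phi>"
  unfolding test_function_def
proof (intro conjI allI)
  have "deriv \<phi> = \<psi>"
    using assms(2) by (auto simp: fun_eq_iff intro: DERIV_imp_deriv)
  then show "(deriv ^^ k) \<phi> differentiable (at u)" for k u
  proof (cases k)
    case 0
    then show ?thesis using assms(2) real_differentiable_def by auto
  next
    case (Suc l)
    then have "(deriv ^^ k) \<phi> = (deriv ^^ l) \<psi>"
      using \<open>deriv \<phi> = \<psi>\<close> by (simp add: funpow_Suc_right del: funpow.simps)
    then show ?thesis
      using assms(1) by (simp add: flat_span_iterated_deriv flat_span_differentiable)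
  qed
  show "\<exists>R. \<forall>u. R < \<bar>u\<bar> \<longrightarrow> \<phi> u = 0" using assms(3) by blast
qed

text \<open>The ramp is the primitive of a bump on the interval, divided by the total mass
  \<open>I\<close> of the bump. The negative of \<psi> is recorded as well because
  \<open>flat_span\<close> offers sums only, while a difference of two ramps is wanted
  later.\<close>

lemma smooth_ramp:
  fixes a b :: real
  assumes "a < b"
  obtains \<Psi> \<psi> where "\<psi> \<in> flat_span" "(\<lambda>x. - \<psi> x) \<in> flat_span"
    "\<And>x. (\<Psi> has_real_derivative \<psi> x) (at x)"
    "\<And>x. 0 \<le> \<psi> x" "\<And>x. x \<notin> {a..b} \<Longrightarrow> \<psi> x = 0"
    "\<And>x. x \<le> a \<Longrightarrow> \<Psi> x = 0" "\<And>x. b \<le> x \<Longrightarrow> \<Psi> x = 1"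
    "\<And>x. 0 \<le> \<Psi> x" "\<And>x. \<Psi> x \<le> 1"
proof -
  \<comment> \<open>The scalar sits inside the first polynomial, so that the normalised bump and its
    negative are both single products.\<close>
  define B where "B c x = flat_exp [:c:] (x - a) * flat_exp 1 (b - x)" for c x
  have B_span: "B c \<in> flat_span" for c
    unfolding B_def[abs_def] by (rule flat_span.prod)
  have B_scale: "B c x = c * B 1 x" for c x
    by (simp add: B_def flat_exp_def)
  have B_nonneg: "0 \<le> B 1 x" for x
    by (simp add: B_def flat_exp_def)
  have B_pos: "0 < B 1 x" if "a < x" "x < b" for x
    using that by (simp add: B_def flat_exp_def)
  have B_zero: "B 1 x = 0" if "x \<notin> {a<..<b}" for x
    using that by (auto simp: B_def flat_exp_def)
  obtain F where F: "\<And>x. (F has_real_derivative B 1 x) (at x)"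
    using einterval_antiderivative[of "-\<infinity>" "\<infinity>" "B 1"] flat_span_isCont[OF B_span]
    by (auto simp: has_real_derivative_iff_has_vector_derivative)
  have mono: "F x \<le> F y" if "x \<le> y" for x y
    using that by (rule DERIV_nonneg_imp_nondecreasing) (use F B_nonneg in blast)
  have "F a < F b"
  proof (rule DERIV_pos_imp_increasing_open[OF assms])
    show "\<exists>y. DERIV F x :> y \<and> 0 < y" if "a < x" "x < b" for x
      using F B_pos[OF that] by blast
    show "continuous_on {a..b} F"
      using F by (meson DERIV_isCont continuous_at_imp_continuous_on)
  qed
  define I where "I = F b - F a"
  have "I > 0" using \<open>F a < F b\<close> by (simp add: I_def)
  have left: "F x = F a" if "x \<le> a" for x
  proof (rule antisym)
    show "F a \<le> F x"
      using that
    proof (rule DERIV_nonpos_imp_nonincreasing)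
      show "\<exists>y. DERIV F z :> y \<and> y \<le> 0" if "x \<le> z" "z \<le> a" for z
        using F[of z] B_zero[of z] that by (intro exI[of _ 0]) auto
    qed
  qed (use mono that in blast)
  have right: "F x = F b" if "b \<le> x" for x
  proof (rule antisym)
    show "F x \<le> F b"
      using that
    proof (rule DERIV_nonpos_imp_nonincreasing)
      show "\<exists>y. DERIV F z :> y \<and> y \<le> 0" if "b \<le> z" "z \<le> x" for z
        using F[of z] B_zero[of z] that by (intro exI[of _ 0]) auto
    qed
  qed (use mono that in blast)
  have between: "F a \<le> F x" "F x \<le> F b" for x
    using mono[of a x] mono[of x b] left[of x] right[of x] \<open>F a < F b\<close> by fastforce+
  have B_I: "B (1 / I) x = B 1 x / I" for x
    using B_scale[of "1 / I" x] by simp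
  show ?thesis
  proof (rule that)
    show "B (1 / I) \<in> flat_span" by (rule B_span)
    have "(\<lambda>x. - B (1 / I) x) = B (- (1 / I))"
    proof
      show "- B (1 / I) x = B (- (1 / I)) x" for x
        using B_scale[of "- (1 / I)" x] B_I[of x] by simp
    qed
    then show "(\<lambda>x. - B (1 / I) x) \<in> flat_span"
      using B_span by simp
    show "((\<lambda>x. (F x - F a) / I) has_real_derivative B (1 / I) x) (at x)" for x
      unfolding B_I using \<open>I > 0\<close> by (auto intro!: derivative_eq_intros F)
    show "0 \<le> B (1 / I) x" for x
      unfolding B_I using B_nonneg[of x] \<open>I > 0\<close> by simp
    show "B (1 / I) x = 0" if "x \<notin> {a..b}" for x
      unfolding B_I using B_zero[of x] that by auto
    show "(F x - F a) / I = 0" if "x \<le> a" for x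
      using left[OF that] by simp
    show "(F x - F a) / I = 1" if "b \<le> x" for x
      using right[OF that] \<open>I > 0\<close> by (simp add: I_def)
    show "0 \<le> (F x - F a) / I" for x
      using between(1)[of x] \<open>I > 0\<close> by simp
    show "(F x - F a) / I \<le> 1" for x
      using between(2)[of x] \<open>I > 0\<close> by (simp add: I_def)
  qed
qed

lemma has_bochner_integral_ramp_derivative:
  fixes \<Psi> \<psi> :: "real \<Rightarrow> real"
  assumes "a < b" "\<And>x. (\<Psi> has_real_derivative \<psi> x) (at x)" "\<And>x. isCont \<psi> x"
    and "\<And>x. x \<notin> {a..b} \<Longrightarrow> \<psi> x = 0" "\<Psi> a = 0" "\<Psi> b = 1"
  shows "has_bochner_integral lborel \<psi> 1"
proof -
  have "has_bochner_integral lborel (\<lambda>x. \<psi> x * indicator {a..b} x) (\<Psi> b - \<Psi> a)"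
    using assms(1-3) by (intro has_bochner_integral_FTC_Icc_real) auto
  moreover have "(\<lambda>x. \<psi> x * indicator {a..b} x) = \<psi>"
    using assms(4) by (auto simp: fun_eq_iff indicator_def)
  ultimately show ?thesis using assms(5,6) by simp
qed

text \<open>As \<psi> has integral 1, subtracting \<open>c\<close> from the average of
  \<open>f\<close> averages f - c, which is at most \<eta> wherever \<psi> is nonzero.\<close>

lemma weighted_average_bound:
  fixes f \<psi> :: "real \<Rightarrow> real"
  assumes "continuous_on UNIV f" and \<psi>: "\<And>x. isCont \<psi> x" "has_bochner_integral lborel \<psi> 1"
    and "\<And>x. 0 \<le> \<psi> x" "\<And>x. x \<notin> {a..b} \<Longrightarrow> \<psi> x = 0"
    and "\<And>x. x \<in> {a..b} \<Longrightarrow> \<bar>f x - c\<bar> \<le> \<eta>"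
  shows "integrable lborel (\<lambda>x. f x * \<psi> x)" "\<bar>(\<integral>x. f x * \<psi> x \<partial>lborel) - c\<bar> \<le> \<eta>"
proof -
  have "integrable lborel (\<lambda>x. (f x * \<psi> x) * indicator {a..b} x)"
    using assms(1) \<psi>(1)
    by (intro borel_integrable_atLeastAtMost continuous_intros)
       (auto simp: continuous_on_eq_continuous_at)
  moreover have "(\<lambda>x. (f x * \<psi> x) * indicator {a..b} x) = (\<lambda>x. f x * \<psi> x)"
    using assms(5) by (auto simp: fun_eq_iff indicator_def)
  ultimately show int: "integrable lborel (\<lambda>x. f x * \<psi> x)" by simp
  have [simp]: "integrable lborel \<psi>" "integral\<^sup>L lborel \<psi> = 1"
    using \<psi>(2) by (auto simp: has_bochner_integral_iff)
  have "(\<integral>x. f x * \<psi> x \<partial>lborel) - c = (\<integral>x. f x * \<psi> x - c * \<psi> x \<partial>lborel)"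
    using int by simp
  also have "\<bar>\<dots>\<bar> \<le> (\<integral>x. \<bar>f x * \<psi> x - c * \<psi> x\<bar> \<partial>lborel)"
    by (rule integral_abs_bound)
  also have "\<dots> \<le> (\<integral>x. \<eta> * \<psi> x \<partial>lborel)"
  proof (rule integral_mono)
    show "\<bar>f x * \<psi> x - c * \<psi> x\<bar> \<le> \<eta> * \<psi> x" for x
      using assms(4)[of x] assms(5,6)[of x]
      by (cases "x \<in> {a..b}") (auto simp: abs_mult mult_right_mono simp flip: left_diff_distrib)
  qed (use int in auto)
  finally show "\<bar>(\<integral>x. f x * \<psi> x \<partial>lborel) - c\<bar> \<le> \<eta>" by simp
qed

section \<open>Increments of Sobolev functions\<close>

text \<open>The test function \<theta> rises from 0 to 1 just right of \<open>a\<close> and falls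
  back to 0 just left of \<open>b\<close>. Against \<theta>', \<open>f\<close> yields an average
  near \<open>a\<close> minus an average near \<open>b\<close>; against \<theta>, \<open>g\<close>
  yields at most the integral of its modulus, as \<theta> is bounded by 1 and supported in
  [a, b].\<close>

lemma weak_derivative_increment:
  fixes f g :: "real \<Rightarrow> real"
  assumes f: "continuous_on UNIV f" and fg: "has_weak_derivative f g" and "a \<le> b"
  shows "\<bar>f b - f a\<bar> \<le> (\<integral>u. \<bar>g u\<bar> * indicator {a..b} u \<partial>lborel)"
proof (cases "a = b")
  case False
  with \<open>a \<le> b\<close> have "a < b" by simp
  have g: "integrable lborel (\<lambda>u. \<bar>g u\<bar> * indicator {a..b} u)"
  proof -
    have "integrable lborel (\<lambda>u. \<bar>indicator {a..b} u *\<^sub>R g u\<bar>)"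
      using fg by (intro integrable_abs) (simp add: has_weak_derivative_def set_integrable_def)
    then show ?thesis by (simp add: abs_mult mult.commute)
  qed
  show ?thesis
  proof (rule field_le_epsilon)
    fix e :: real assume "0 < e"
    \<comment> \<open>Each of the two endpoint averages costs \<eta>.\<close>
    define \<eta> where "\<eta> = e / 2"
    have "\<eta> > 0" using \<open>0 < e\<close> by (simp add: \<eta>_def)
    from f \<open>\<eta> > 0\<close> obtain d1 where d1: "d1 > 0" "\<And>x. \<bar>x - a\<bar> < d1 \<Longrightarrow> \<bar>f x - f a\<bar> < \<eta>"
      unfolding continuous_on_iff dist_real_def by (metis UNIV_I)
    from f \<open>\<eta> > 0\<close> obtain d2 where d2: "d2 > 0" "\<And>x. \<bar>x - b\<bar> < d2 \<Longrightarrow> \<bar>f x - f b\<bar> < \<eta>"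
      unfolding continuous_on_iff dist_real_def by (metis UNIV_I)
    \<comment> \<open>Halving keeps \<open>d\<close> strictly below both continuity radii and keeps
      the two ramps from overlapping in more than a point.\<close>
    define d where "d = min (b - a) (min d1 d2) / 2"
    have d: "d > 0" "d < d1" "d < d2" "a + d < b" "a < b - d"
      using d1(1) d2(1) \<open>a < b\<close> by (auto simp: d_def min_def field_simps)
    obtain \<Phi> \<phi> where \<phi>: "\<phi> \<in> flat_span" "(\<lambda>x. - \<phi> x) \<in> flat_span"
        "\<And>x. (\<Phi> has_real_derivative \<phi> x) (at x)"
        "\<And>x. 0 \<le> \<phi> x" "\<And>x. x \<notin> {a..a + d} \<Longrightarrow> \<phi> x = 0"
        "\<And>x. x \<le> a \<Longrightarrow> \<Phi> x = 0" "\<And>x. a + d \<le> x \<Longrightarrow> \<Phi> x = 1"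
        "\<And>x. 0 \<le> \<Phi> x" "\<And>x. \<Phi> x \<le> 1"
      by (rule smooth_ramp[of a "a + d"]) (use d in simp, rule that, assumption+)
    obtain \<Psi> \<psi> where \<psi>: "\<psi> \<in> flat_span" "(\<lambda>x. - \<psi> x) \<in> flat_span"
        "\<And>x. (\<Psi> has_real_derivative \<psi> x) (at x)"
        "\<And>x. 0 \<le> \<psi> x" "\<And>x. x \<notin> {b - d..b} \<Longrightarrow> \<psi> x = 0"
        "\<And>x. x \<le> b - d \<Longrightarrow> \<Psi> x = 0" "\<And>x. b \<le> x \<Longrightarrow> \<Psi> x = 1"
        "\<And>x. 0 \<le> \<Psi> x" "\<And>x. \<Psi> x \<le> 1"
      by (rule smooth_ramp[of "b - d" b]) (use d in simp, rule that, assumption+)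
    define \<theta> where "\<theta> x = \<Phi> x - \<Psi> x" for x
    have \<theta>_deriv: "(\<theta> has_real_derivative \<phi> x - \<psi> x) (at x)" for x
      unfolding \<theta>_def[abs_def] using \<phi>(3) \<psi>(3) by (intro DERIV_diff)
    have \<theta>_zero: "\<theta> x = 0" if "x \<notin> {a..b}" for x
      using that \<phi>(6,7)[of x] \<psi>(6,7)[of x] d by (auto simp: \<theta>_def not_le)
    have \<theta>_le: "\<bar>\<theta> x\<bar> \<le> 1" for x
      using \<phi>(8,9)[of x] \<psi>(8,9)[of x] by (auto simp: \<theta>_def)
    have "(\<lambda>x. \<phi> x - \<psi> x) \<in> flat_span"
      using flat_span.add[OF \<phi>(1) \<psi>(2)] by simp
    then have "test_function \<theta>"
      using \<theta>_deriv \<theta>_zero by (rule test_function_primitive[where R = "max \<bar>a\<bar> \<bar>b\<bar>"]) auto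
    then have "(\<integral>u. f u * deriv \<theta> u \<partial>lborel) = - (\<integral>u. g u * \<theta> u \<partial>lborel)"
      using fg by (simp add: has_weak_derivative_def)
    moreover have "\<bar>\<integral>u. g u * \<theta> u \<partial>lborel\<bar> \<le> (\<integral>u. \<bar>g u\<bar> * indicator {a..b} u \<partial>lborel)"
    proof -
      have "\<bar>\<integral>u. g u * \<theta> u \<partial>lborel\<bar> \<le> (\<integral>u. \<bar>g u * \<theta> u\<bar> \<partial>lborel)"
        by (rule integral_abs_bound)
      also have "\<dots> \<le> (\<integral>u. \<bar>g u\<bar> * indicator {a..b} u \<partial>lborel)"
        using g
      proof (rule integral_mono')
        show "\<bar>g u * \<theta> u\<bar> \<le> \<bar>g u\<bar> * indicator {a..b} u" for u
          using \<theta>_le[of u] \<theta>_zero[of u] by (auto simp: abs_mult mult_left_le split: split_indicator)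
      qed auto
      finally show ?thesis .
    qed
    moreover have "(\<integral>u. f u * deriv \<theta> u \<partial>lborel)
        = (\<integral>u. f u * \<phi> u \<partial>lborel) - (\<integral>u. f u * \<psi> u \<partial>lborel)"
      and "\<bar>(\<integral>u. f u * \<phi> u \<partial>lborel) - f a\<bar> \<le> \<eta>"
      and "\<bar>(\<integral>u. f u * \<psi> u \<partial>lborel) - f b\<bar> \<le> \<eta>"
    proof -
      have \<phi>_one: "has_bochner_integral lborel \<phi> 1"
        using \<phi> d by (intro has_bochner_integral_ramp_derivative[of a "a + d" \<Phi>] flat_span_isCont) auto
      have \<psi>_one: "has_bochner_integral lborel \<psi> 1"
        using \<psi> d by (intro has_bochner_integral_ramp_derivative[of "b - d" b \<Psi>] flat_span_isCont) auto
      have f_a: "\<bar>f x - f a\<bar> \<le> \<eta>" if "x \<in> {a..a + d}" for x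
        using that d d1(2)[of x] by auto
      have f_b: "\<bar>f x - f b\<bar> \<le> \<eta>" if "x \<in> {b - d..b}" for x
        using that d d2(2)[of x] by auto
      note avg_a = weighted_average_bound[OF f flat_span_isCont[OF \<phi>(1)] \<phi>_one \<phi>(4,5) f_a]
      note avg_b = weighted_average_bound[OF f flat_span_isCont[OF \<psi>(1)] \<psi>_one \<psi>(4,5) f_b]
      have "deriv \<theta> = (\<lambda>x. \<phi> x - \<psi> x)"
        using \<theta>_deriv by (auto simp: fun_eq_iff intro: DERIV_imp_deriv)
      then show "(\<integral>u. f u * deriv \<theta> u \<partial>lborel)
          = (\<integral>u. f u * \<phi> u \<partial>lborel) - (\<integral>u. f u * \<psi> u \<partial>lborel)"
        using avg_a(1) avg_b(1) by (simp add: right_diff_distrib)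
      show "\<bar>(\<integral>u. f u * \<phi> u \<partial>lborel) - f a\<bar> \<le> \<eta>" by (rule avg_a(2))
      show "\<bar>(\<integral>u. f u * \<psi> u \<partial>lborel) - f b\<bar> \<le> \<eta>" by (rule avg_b(2))
    qed
    ultimately show "\<bar>f b - f a\<bar> \<le> (\<integral>u. \<bar>g u\<bar> * indicator {a..b} u \<partial>lborel) + e"
      using \<eta>_def by linarith
  qed
qed simp

section \<open>Weighted tail integrals and pointwise bounds for functions in K\<close>

text \<open>The antiderivative -(1 + u)^(-k) / k handles the right half-line, and reflection handles
  the left one. The lemma serves k = 6, for the weight of the derivative, and k = 5, for squared
  compositions.\<close>

lemma nn_integral_power_tail:
  fixes r :: real
  assumes "0 \<le> r" "0 < k"
  shows "(\<integral>\<^sup>+u. ennreal (1 / (1 + \<bar>u\<bar>) ^ Suc k) * indicator {u. r \<le> \<bar>u\<bar>} u \<partial>lborel)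
    \<le> ennreal (2 / (real k * (1 + r) ^ k))"
proof -
  define w :: "real \<Rightarrow> real" where "w u = 1 / (1 + \<bar>u\<bar>) ^ Suc k" for u
  define F :: "real \<Rightarrow> real" where "F u = - (1 / k) * inverse (1 + u) ^ k" for u
  have [measurable]: "w \<in> borel_measurable borel"
    unfolding w_def[abs_def] by measurable
  have "(\<integral>\<^sup>+u. ennreal (w u) * indicator {r..} u \<partial>lborel) = 0 - F r"
  proof (rule nn_integral_FTC_atLeast)
    show "(F has_real_derivative w x) (at x)" if "r \<le> x" for x
    proof -
      have "(F has_real_derivative
          - (1 / k) * (real k * (inverse (1 + x) ^ (k - Suc 0) * (- (inverse (1 + x) * inverse (1 + x)))))) (at x)"
        unfolding F_def[abs_def] using that assms
        by (auto intro!: derivative_eq_intros)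
      moreover have "- (1 / k) * (real k * (inverse (1 + x) ^ (k - Suc 0) * (- (inverse (1 + x) * inverse (1 + x)))))
          = inverse (1 + x) ^ Suc k"
        using assms(2) by (cases k) auto
      moreover have "inverse (1 + x) ^ Suc k = w x"
        using that assms by (simp add: w_def divide_inverse power_inverse)
      ultimately show ?thesis by metis
    qed
    have "((\<lambda>u. - (1 / k) * inverse (1 + u) ^ k) \<longlongrightarrow> - (1 / k) * 0 ^ k) at_top"
      by (intro tendsto_intros filterlim_compose[OF tendsto_inverse_0]
          filterlim_at_top_imp_at_infinity filterlim_tendsto_add_at_top[OF tendsto_const] filterlim_ident)
    then show "(F \<longlongrightarrow> 0) at_top"
      using assms(2) by (simp add: F_def[abs_def] zero_power)
  qed (auto simp: w_def)
  then have right: "(\<integral>\<^sup>+u. ennreal (w u) * indicator {r..} u \<partial>lborel) = ennreal (1 / (real k * (1 + r) ^ k))"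
    by (simp add: F_def power_inverse divide_inverse)
  have "(\<integral>\<^sup>+u. ennreal (w u) * indicator {..- r} u \<partial>lborel)
      = (\<integral>\<^sup>+u. ennreal (w (0 + - 1 * u)) * indicator {..- r} (0 + - 1 * u) \<partial>lborel)"
    by (subst nn_integral_real_affine[where c = "- 1" and t = 0]) auto
  also have "\<dots> = (\<integral>\<^sup>+u. ennreal (w u) * indicator {r..} u \<partial>lborel)"
    by (intro nn_integral_cong) (auto simp: w_def split: split_indicator)
  finally have left: "(\<integral>\<^sup>+u. ennreal (w u) * indicator {..- r} u \<partial>lborel) = ennreal (1 / (real k * (1 + r) ^ k))"
    using right by simp
  have "(\<integral>\<^sup>+u. ennreal (w u) * indicator {u. r \<le> \<bar>u\<bar>} u \<partial>lborel)
      \<le> (\<integral>\<^sup>+u. ennreal (w u) * indicator {r..} u + ennreal (w u) * indicator {..- r} u \<partial>lborel)"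
    by (intro nn_integral_mono) (auto simp: abs_if split: split_indicator)
  also have "\<dots> = ennreal (1 / (real k * (1 + r) ^ k)) + ennreal (1 / (real k * (1 + r) ^ k))"
    using left right by (subst nn_integral_add) auto
  also have "\<dots> = ennreal (2 / (real k * (1 + r) ^ k))"
    using assms by (subst ennreal_plus[symmetric]) auto
  finally show ?thesis by (simp add: w_def)
qed

text \<open>Weighted Cauchy-Schwarz with a free parameter: pointwise AM-GM replaces the product of
  norms, and s = sqrt V would recover the usual bound sqrt V when V > 0.\<close>

lemma K_set_increment:
  assumes "f \<in> K_set" "a \<le> b" "0 < s" "0 \<le> V"
    and V: "(\<integral>\<^sup>+u. ennreal (1 / (1 + \<bar>u\<bar>) ^ 7) * indicator {a..b} u \<partial>lborel) \<le> ennreal V"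
  shows "\<bar>f b - f a\<bar> \<le> (s + V / s) / 2"
proof -
  define w :: "real \<Rightarrow> real" where "w u = (1 + \<bar>u\<bar>) ^ 7" for u
  have [measurable]: "w \<in> borel_measurable borel"
    unfolding w_def[abs_def] by measurable
  have w_pos: "0 < w u" for u
    by (simp add: w_def)
  from \<open>f \<in> K_set\<close> obtain g where f: "continuous_on UNIV f" and fg: "has_weak_derivative f g"
    and le: "(\<integral>\<^sup>+u. ennreal ((f u)\<^sup>2 * (1 + \<bar>u\<bar>) ^ 3) \<partial>lborel)
       + (\<integral>\<^sup>+u. ennreal ((g u)\<^sup>2 * w u) \<partial>lborel) \<le> 1"
    by (auto simp: K_set_def W21_def w_def)
  have g_le: "(\<integral>\<^sup>+u. ennreal ((g u)\<^sup>2 * w u) \<partial>lborel) \<le> 1"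
    using le by (rule order_trans[rotated]) simp
  define G where "G u = g u * indicator {a..b} u" for u
  have G_int: "integrable lborel G"
    using fg by (simp add: has_weak_derivative_def set_integrable_def G_def[abs_def] mult.commute)
  then have [measurable]: "G \<in> borel_measurable borel" by auto
  have G_abs: "\<bar>G u\<bar> = \<bar>g u\<bar> * indicator {a..b} u" for u
    by (simp add: G_def abs_mult)
  have "ennreal \<bar>f b - f a\<bar> \<le> ennreal (\<integral>u. \<bar>G u\<bar> \<partial>lborel)"
    using weak_derivative_increment[OF f fg \<open>a \<le> b\<close>] by (simp add: G_abs)
  also have "\<dots> = (\<integral>\<^sup>+u. ennreal \<bar>G u\<bar> \<partial>lborel)"
    using G_int by (intro nn_integral_eq_integral[symmetric]) auto
  also have "\<dots> \<le> (\<integral>\<^sup>+u. ennreal (s / 2) * ennreal ((G u)\<^sup>2 * w u)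
      + ennreal (1 / (2 * s)) * (ennreal (1 / w u) * indicator {a..b} u) \<partial>lborel)"
  proof (rule nn_integral_mono)
    fix u
    \<comment> \<open>AM-GM, with equality for \<open>\<bar>G u\<bar> = 1 / (s w(u))\<close>\<close>
    have "0 \<le> (s * w u * \<bar>G u\<bar> - 1)\<^sup>2 / (2 * s * w u)"
      using w_pos[of u] \<open>0 < s\<close> by simp
    also have "\<dots> = s / 2 * ((G u)\<^sup>2 * w u) + 1 / (2 * s) * (1 / w u) - \<bar>G u\<bar>"
      using w_pos[of u] \<open>0 < s\<close> by (simp add: power2_diff power_mult_distrib field_simps power2_eq_square)
    finally have "\<bar>G u\<bar> \<le> s / 2 * ((G u)\<^sup>2 * w u) + 1 / (2 * s) * (1 / w u)" by simp
    then show "ennreal \<bar>G u\<bar> \<le> ennreal (s / 2) * ennreal ((G u)\<^sup>2 * w u)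
        + ennreal (1 / (2 * s)) * (ennreal (1 / w u) * indicator {a..b} u)"
      using w_pos[of u] \<open>0 < s\<close>
      by (cases "u \<in> {a..b}")
         (auto simp: G_def ennreal_mult[symmetric] ennreal_plus[symmetric] simp del: ennreal_plus
           intro!: ennreal_leI)
  qed
  also have "\<dots> = ennreal (s / 2) * (\<integral>\<^sup>+u. ennreal ((G u)\<^sup>2 * w u) \<partial>lborel)
      + ennreal (1 / (2 * s)) * (\<integral>\<^sup>+u. ennreal (1 / w u) * indicator {a..b} u \<partial>lborel)"
    by (simp add: nn_integral_add nn_integral_cmult)
  also have "\<dots> \<le> ennreal (s / 2) * 1 + ennreal (1 / (2 * s)) * ennreal V"
  proof (intro add_mono mult_left_mono)
    have "(\<integral>\<^sup>+u. ennreal ((G u)\<^sup>2 * w u) \<partial>lborel) \<le> (\<integral>\<^sup>+u. ennreal ((g u)\<^sup>2 * w u) \<partial>lborel)"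
      by (intro nn_integral_mono) (auto simp: G_def split: split_indicator)
    with g_le show "(\<integral>\<^sup>+u. ennreal ((G u)\<^sup>2 * w u) \<partial>lborel) \<le> 1" by (rule order_trans[rotated])
    show "(\<integral>\<^sup>+u. ennreal (1 / w u) * indicator {a..b} u \<partial>lborel) \<le> ennreal V"
      using V by (simp add: w_def)
  qed auto
  also have "\<dots> = ennreal (s / 2 + V / (2 * s))"
    using \<open>0 < s\<close> \<open>0 \<le> V\<close> by (simp add: ennreal_mult[symmetric] ennreal_plus[symmetric] del: ennreal_plus)
  finally have "\<bar>f b - f a\<bar> \<le> s / 2 + V / (2 * s)"
    using \<open>0 < s\<close> \<open>0 \<le> V\<close> by (subst (asm) ennreal_le_iff) auto
  then show ?thesis using \<open>0 < s\<close> by (simp add: field_simps)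
qed

text \<open>The weight 1 / (1 + |u|)^7 is at most 1, so V = b - a is admissible for a < b, and s =
  sqrt (b - a) is the optimal parameter.\<close>

lemma K_set_holder:
  assumes "f \<in> K_set"
  shows "(f b - f a)\<^sup>2 \<le> \<bar>b - a\<bar>"
proof -
  have *: "(f b - f a)\<^sup>2 \<le> b - a" if "a < b" for a b
  proof -
    have "(\<integral>\<^sup>+u. ennreal (1 / (1 + \<bar>u\<bar>) ^ 7) * indicator {a..b} u \<partial>lborel)
        \<le> (\<integral>\<^sup>+u. indicator {a..b} u \<partial>lborel)"
      by (intro nn_integral_mono) (auto split: split_indicator)
    also have "\<dots> = ennreal (b - a)" using that by simp
    finally have "\<bar>f b - f a\<bar> \<le> (sqrt (b - a) + (b - a) / sqrt (b - a)) / 2"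
      using that assms by (intro K_set_increment) auto
    also have "\<dots> = sqrt (b - a)"
      using that by (simp add: real_div_sqrt)
    finally show ?thesis
      using that by (metis abs_le_square_iff abs_of_nonneg diff_ge_0_iff_ge less_imp_le
          real_sqrt_ge_zero real_sqrt_pow2)
  qed
  show ?thesis
    using *[of a b] *[of b a] by (cases a b rule: linorder_cases) (auto simp: power2_commute)
qed

text \<open>Moving away from the origin, \<open>f\<close> changes by at most s = (1 + |y|)^(-3),
  because the weight has tail at most s^2 / 3. If |f y| exceeded s, then |f| would stay above a
  positive constant on a half-line, against square integrability.\<close>

lemma K_set_decay:
  assumes "f \<in> K_set"
  shows "\<bar>f y\<bar> \<le> 1 / (1 + \<bar>y\<bar>) ^ 3"
proof (rule ccontr)
  define s where "s = 1 / (1 + \<bar>y\<bar>) ^ 3"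
  have "s > 0" by (simp add: s_def)
  have incr: "\<bar>f b - f a\<bar> \<le> s" if "a \<le> b" "{a..b} \<subseteq> {u. \<bar>y\<bar> \<le> \<bar>u\<bar>}" for a b
  proof -
    have "(\<integral>\<^sup>+u. ennreal (1 / (1 + \<bar>u\<bar>) ^ 7) * indicator {a..b} u \<partial>lborel)
        \<le> (\<integral>\<^sup>+u. ennreal (1 / (1 + \<bar>u\<bar>) ^ Suc 6) * indicator {u. \<bar>y\<bar> \<le> \<bar>u\<bar>} u \<partial>lborel)"
      using that(2) by (intro nn_integral_mono) (auto split: split_indicator)
    also have "\<dots> \<le> ennreal (2 / (real 6 * (1 + \<bar>y\<bar>) ^ 6))"
      by (rule nn_integral_power_tail) auto
    also have "2 / (real 6 * (1 + \<bar>y\<bar>) ^ 6) = s\<^sup>2 / 3"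
      by (simp add: s_def power_divide flip: power_mult)
    finally have "\<bar>f b - f a\<bar> \<le> (s + s\<^sup>2 / 3 / s) / 2"
      using that \<open>s > 0\<close> assms by (intro K_set_increment) auto
    also have "\<dots> \<le> s" using \<open>s > 0\<close> by (simp add: power2_eq_square)
    finally show ?thesis .
  qed
  assume "\<not> \<bar>f y\<bar> \<le> 1 / (1 + \<bar>y\<bar>) ^ 3"
  then have "\<bar>f y\<bar> - s > 0" by (simp add: s_def)
  define c where "c = \<bar>f y\<bar> - s"
  have "c > 0" using \<open>\<bar>f y\<bar> - s > 0\<close> by (simp add: c_def)
  define J where "J = (\<integral>u. (f u)\<^sup>2 \<partial>lborel)"
  \<comment> \<open>This length makes c^2 T = J + c^2, more than the whole integral of f^2.\<close>
  define T where "T = J / c\<^sup>2 + 1"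
  have "J \<ge> 0" by (simp add: J_def)
  then have "T > 0" using \<open>c > 0\<close> by (simp add: T_def add_nonneg_pos)
  have f: "integrable lborel (\<lambda>u. (f u)\<^sup>2)"
    using assms by (simp add: K_set_def W21_def L2_functions_def)
  \<comment> \<open>The window of length \<open>T\<close> has \<open>y\<close> as its end nearest
    the origin, so |u| is at least |y| throughout.\<close>
  define l where "l = (if 0 \<le> y then y else y - T)"
  have large: "c\<^sup>2 \<le> (f z)\<^sup>2" if "z \<in> {l..l + T}" for z
  proof -
    have "\<bar>f z - f y\<bar> \<le> s"
    proof (cases "0 \<le> y")
      case True
      then have "{y..z} \<subseteq> {u. \<bar>y\<bar> \<le> \<bar>u\<bar>}" by auto
      then show ?thesis using incr[of y z] that True by (simp add: l_def)
    next
      case False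
      then have "{z..y} \<subseteq> {u. \<bar>y\<bar> \<le> \<bar>u\<bar>}" by auto
      then show ?thesis using incr[of z y] that False by (simp add: l_def abs_minus_commute)
    qed
    then have "c \<le> \<bar>f z\<bar>" by (simp add: c_def)
    then have "c\<^sup>2 \<le> \<bar>f z\<bar>\<^sup>2" using \<open>c > 0\<close> by (intro power_mono) auto
    then show ?thesis by simp
  qed
  have "c\<^sup>2 * T = (\<integral>u. c\<^sup>2 * indicator {l..l + T} u \<partial>lborel)"
    using \<open>T > 0\<close> by simp
  also have "\<dots> \<le> J"
    unfolding J_def using f
    by (rule integral_mono') (use large in \<open>auto split: split_indicator\<close>)
  finally show False
    using \<open>c > 0\<close> by (simp add: T_def distrib_left)
qed

section \<open>Widths of images of \<open>K\<close> under composition\<close>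

lemma to_L2_add:
  "f \<in> L2_functions \<Longrightarrow> g \<in> L2_functions \<Longrightarrow> to_L2 (\<lambda>u. f u + g u) = to_L2 f + to_L2 g"
  unfolding to_L2_def by (subst plus_L2.abs_eq) (auto simp: L2_rel_def)

lemma to_L2_scaleR:
  "f \<in> L2_functions \<Longrightarrow> to_L2 (\<lambda>u. c * f u) = c *\<^sub>R to_L2 f"
  unfolding to_L2_def by (subst scaleR_L2.abs_eq) (auto simp: L2_rel_def)

lemma to_L2_zero: "to_L2 (\<lambda>u. 0) = 0"
  unfolding to_L2_def zero_L2_def ..

lemma L2_functions_diff:
  "f \<in> L2_functions \<Longrightarrow> g \<in> L2_functions \<Longrightarrow> (\<lambda>u. f u - g u) \<in> L2_functions"
  using L2_functions_add[OF _ L2_functions_scale[of g "- 1"]] by simp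

lemma to_L2_diff:
  "f \<in> L2_functions \<Longrightarrow> g \<in> L2_functions \<Longrightarrow> to_L2 (\<lambda>u. f u - g u) = to_L2 f - to_L2 g"
  using to_L2_add[of f "\<lambda>u. - 1 * g u"] L2_functions_scale[of g "- 1"] to_L2_scaleR[of g "- 1"] by simp

lemma L2_functions_sum:
  fixes n :: nat
  shows "(\<And>j. j < n \<Longrightarrow> h j \<in> L2_functions) \<Longrightarrow> (\<lambda>u. \<Sum>j<n. c j * h j u) \<in> L2_functions"
  by (induction n) (auto intro!: L2_functions_zero L2_functions_add L2_functions_scale)

lemma to_L2_sum_in_span:
  fixes n :: nat
  shows "(\<And>j. j < n \<Longrightarrow> h j \<in> L2_functions)
    \<Longrightarrow> to_L2 (\<lambda>u. \<Sum>j<n. c j * h j u) \<in> span ((\<lambda>j. to_L2 (h j)) ` {..<n})"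
proof (induction n)
  case (Suc n)
  have "to_L2 (\<lambda>u. \<Sum>j<Suc n. c j * h j u) = to_L2 (\<lambda>u. \<Sum>j<n. c j * h j u) + c n *\<^sub>R to_L2 (h n)"
    using Suc.prems by (simp add: to_L2_add to_L2_scaleR L2_functions_sum L2_functions_scale)
  moreover have "to_L2 (\<lambda>u. \<Sum>j<n. c j * h j u) \<in> span ((\<lambda>j. to_L2 (h j)) ` {..<Suc n})"
    by (rule subsetD[OF span_mono, rotated]) (use Suc in auto)
  moreover have "to_L2 (h n) \<in> span ((\<lambda>j. to_L2 (h j)) ` {..<Suc n})"
    by (intro span_base) auto
  ultimately show ?case by (simp add: span_add span_scale)
qed (simp add: to_L2_zero span_zero)

lemma L2_functionsI:
  assumes "f \<in> borel_measurable borel" "(\<integral>\<^sup>+u. ennreal ((f u)\<^sup>2) \<partial>lborel) \<le> ennreal b"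
  shows "f \<in> L2_functions"
  using assms
  by (auto simp: L2_functions_def integrable_iff_bounded intro: le_less_trans ennreal_less_top)

lemma norm_to_L2_le:
  assumes "f \<in> L2_functions" "(\<integral>\<^sup>+u. ennreal ((f u)\<^sup>2) \<partial>lborel) \<le> ennreal (b\<^sup>2)" "0 \<le> b"
  shows "norm (to_L2 f) \<le> b"
proof -
  have "inner (to_L2 f) (to_L2 f) = (\<integral>u. f u * f u \<partial>lborel)"
    using assms(1) unfolding to_L2_def by (subst inner_L2.abs_eq) (auto simp: L2_rel_def)
  also have "\<dots> = (\<integral>u. (f u)\<^sup>2 \<partial>lborel)"
    by (simp add: power2_eq_square)
  finally have "norm (to_L2 f) = sqrt (\<integral>u. (f u)\<^sup>2 \<partial>lborel)"
    by (simp add: norm_eq_sqrt_inner)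
  moreover have "ennreal (\<integral>u. (f u)\<^sup>2 \<partial>lborel) \<le> ennreal (b\<^sup>2)"
    using assms(1,2) by (subst nn_integral_eq_integral[symmetric]) (auto simp: L2_functions_def)
  ultimately show ?thesis
    using assms(3) by (simp add: real_sqrt_le_iff' real_le_lsqrt)
qed

text \<open>The span of \<open>B\<close> is an admissible subspace, since \<open>card B\<close>
  bounds its dimension even when the generators are dependent. This allows for empty cells later,
  whose indicators are zero.\<close>

lemma kolmogorov_width_le:
  fixes C :: "'a::real_inner set"
  assumes "finite B" "card B \<le> n" "\<And>f. f \<in> C \<Longrightarrow> \<exists>g\<in>span B. norm (f - g) \<le> e"
  shows "kolmogorov_width n C \<le> ennreal e"
  unfolding kolmogorov_width_def
proof (rule INF_lower2)
  show "span B \<in> {L. subspace L \<and> (\<exists>B. finite B \<and> span B = L) \<and> dim L \<le> n}"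
    using assms(1,2) dim_le_card'[of B] by auto
  show "(SUP f\<in>C. INF g\<in>span B. ennreal (norm (f - g))) \<le> ennreal e"
  proof (rule SUP_least)
    fix f assume "f \<in> C"
    with assms(3) obtain g where "g \<in> span B" "norm (f - g) \<le> e" by blast
    then show "(INF g\<in>span B. ennreal (norm (f - g))) \<le> ennreal e"
      by (intro INF_lower2[of g] ennreal_leI)
  qed
qed

section \<open>Composition with a map of two-sided linear growth\<close>

text \<open>The lower growth bound on X turns decay of \<open>f\<close> in X u into decay in u.
  Squaring doubles the exponent 3; \<open>Suc 5\<close> is the shape of the tail estimate.\<close>

lemma composition_decay:
  fixes X :: "real \<Rightarrow> real"
  assumes "f \<in> K_set" "0 \<le> C" "1 + \<bar>u\<bar> \<le> C * (1 + \<bar>X u\<bar>)"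
  shows "(f (X u))\<^sup>2 \<le> C ^ 6 * (1 / (1 + \<bar>u\<bar>) ^ Suc 5)"
proof -
  have "(1 + \<bar>u\<bar>) ^ 6 \<le> (C * (1 + \<bar>X u\<bar>)) ^ 6"
    using assms by (intro power_mono) auto
  then have "1 / (1 + \<bar>X u\<bar>) ^ 6 \<le> C ^ 6 * (1 / (1 + \<bar>u\<bar>) ^ 6)"
    unfolding power_mult_distrib by (simp add: field_simps)
  moreover have "(f (X u))\<^sup>2 \<le> (1 / (1 + \<bar>X u\<bar>) ^ 3)\<^sup>2"
    using K_set_decay[OF assms(1), of "X u"] by (metis abs_ge_zero power2_abs power_mono)
  ultimately show ?thesis
    by (simp add: power_divide flip: power_mult)
qed

text \<open>The previous bound is integrable over the line: it is the tail estimate with r =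
  0.\<close>

lemma composition_in_L2:
  fixes X :: "real \<Rightarrow> real"
  assumes "f \<in> K_set" "X \<in> borel_measurable borel" "0 \<le> C"
    and "\<And>u. 1 + \<bar>u\<bar> \<le> C * (1 + \<bar>X u\<bar>)"
  shows "(\<lambda>u. f (X u)) \<in> L2_functions"
proof (rule L2_functionsI)
  have "f \<in> borel_measurable borel"
    using assms(1) by (intro borel_measurable_continuous_onI) (simp add: K_set_def W21_def)
  then show "(\<lambda>u. f (X u)) \<in> borel_measurable borel"
    using assms(2) by measurable
  have "(\<integral>\<^sup>+u. ennreal ((f (X u))\<^sup>2) \<partial>lborel)
      \<le> (\<integral>\<^sup>+u. ennreal (C ^ 6) * (ennreal (1 / (1 + \<bar>u\<bar>) ^ Suc 5) * indicator {u. 0 \<le> \<bar>u\<bar>} u) \<partial>lborel)"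
  proof (rule nn_integral_mono)
    show "ennreal ((f (X u))\<^sup>2)
        \<le> ennreal (C ^ 6) * (ennreal (1 / (1 + \<bar>u\<bar>) ^ Suc 5) * indicator {u. 0 \<le> \<bar>u\<bar>} u)" for u
      using ennreal_leI[OF composition_decay[OF assms(1,3,4), where u = u]] assms(3)
      by (simp add: ennreal_mult[symmetric])
  qed
  also have "\<dots> = ennreal (C ^ 6) * (\<integral>\<^sup>+u. ennreal (1 / (1 + \<bar>u\<bar>) ^ Suc 5) * indicator {u. 0 \<le> \<bar>u\<bar>} u \<partial>lborel)"
    by (rule nn_integral_cmult) measurable
  also have "\<dots> \<le> ennreal (C ^ 6) * ennreal (2 / (real 5 * (1 + 0) ^ 5))"
    by (intro mult_left_mono nn_integral_power_tail) auto
  also have "\<dots> = ennreal (C ^ 6 * (2 / 5))"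
    using assms(3) by (simp add: ennreal_mult[symmetric])
  finally show "(\<integral>\<^sup>+u. ennreal ((f (X u))\<^sup>2) \<partial>lborel) \<le> ennreal (C ^ 6 * (2 / 5))" .
qed

text \<open>Cutting at \<open>\<bar>u\<bar> = U\<close> and using \<open>n\<close> cells in the range of \<open>X\<close> leaves a squared error of order
  \<open>U\<^sup>2 / n + U\<^sup>-\<^sup>5\<close>; the choice \<open>U = n\<^sup>1\<^sup>/\<^sup>5\<close> makes it of order \<open>n\<^sup>-\<^sup>3\<^sup>/\<^sup>5\<close>.\<close>

lemma kolmogorov_width_composition:
  fixes X :: "real \<Rightarrow> real"
  assumes X[measurable]: "X \<in> borel_measurable borel" and "1 \<le> C" "1 \<le> n"
    and up: "\<And>u. \<bar>X u\<bar> \<le> C * (1 + \<bar>u\<bar>)" and low: "\<And>u. 1 + \<bar>u\<bar> \<le> C * (1 + \<bar>X u\<bar>)"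
  shows "kolmogorov_width n (to_L2 ` (\<lambda>f u. f (X u)) ` K_set)
    \<le> ennreal (sqrt (12 * C + C ^ 6) / real n powr (3 / 10))"
proof -
  define U where "U = real n powr (1 / 5)"
  \<comment> \<open>On the window X takes values in [-Y, Y], which is cut into cells of width
    \<delta>. The factor 3 instead of 2 keeps (X u + Y) / \<delta> at most 2 n / 3, so the index
    stays below \<open>n\<close> even when X u = Y.\<close>
  define Y where "Y = C * (1 + U)"
  define \<delta> where "\<delta> = 3 * Y / n"
  define cell where "cell u = nat \<lfloor>(X u + Y) / \<delta>\<rfloor>" for u
  \<comment> \<open>These sets depend on X and \<open>n\<close> but not on \<open>f\<close>, so
    their indicators span one subspace serving all of K.\<close>
  define A where "A j = {u. \<bar>u\<bar> \<le> U \<and> cell u = j}" for j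
  define e where "e = sqrt (12 * C + C ^ 6) / real n powr (3 / 10)"
  have "1 \<le> U" using \<open>1 \<le> n\<close> by (simp add: U_def ge_one_powr_ge_zero)
  have "0 < Y" using \<open>1 \<le> U\<close> \<open>1 \<le> C\<close> by (simp add: Y_def)
  then have "0 < \<delta>" using \<open>1 \<le> n\<close> by (simp add: \<delta>_def)
  have X_le: "\<bar>X u\<bar> \<le> Y" if "\<bar>u\<bar> \<le> U" for u
    using up[of u] that \<open>1 \<le> C\<close> unfolding Y_def
    by (meson add_left_mono dual_order.trans mult_left_mono zero_le_one)
  have cell: "cell u < n" "\<bar>X u - (- Y + cell u * \<delta>)\<bar> \<le> \<delta>" if "\<bar>u\<bar> \<le> U" for u
  proof -
    have pos: "0 \<le> (X u + Y) / \<delta>"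
      using X_le[OF that] \<open>0 < \<delta>\<close> by simp
    have "(X u + Y) / \<delta> \<le> 2 * Y / \<delta>"
      using X_le[OF that] \<open>0 < \<delta>\<close> by (intro divide_right_mono) auto
    also have "\<dots> = 2 * n / 3"
      using \<open>0 < Y\<close> by (simp add: \<delta>_def)
    also have "\<dots> < n" using \<open>1 \<le> n\<close> by simp
    finally show "cell u < n"
      using pos by (simp add: cell_def nat_less_iff floor_less_iff)
    have "real (cell u) = \<lfloor>(X u + Y) / \<delta>\<rfloor>"
      using pos by (simp add: cell_def)
    then have "real (cell u) \<le> (X u + Y) / \<delta>" "(X u + Y) / \<delta> \<le> real (cell u) + 1"
      by linarith+
    then have "cell u * \<delta> \<le> X u + Y" "X u + Y \<le> cell u * \<delta> + \<delta>"
      using \<open>0 < \<delta>\<close> by (simp_all add: field_simps)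
    then show "\<bar>X u - (- Y + cell u * \<delta>)\<bar> \<le> \<delta>" by linarith
  qed
  have [measurable]: "A j \<in> sets borel" for j
    unfolding A_def cell_def by measurable
  have A_L2: "indicator (A j) \<in> L2_functions" for j
  proof (rule L2_functionsI)
    have "(\<integral>\<^sup>+u. ennreal ((indicator (A j) u)\<^sup>2) \<partial>lborel) \<le> (\<integral>\<^sup>+u. indicator {- U..U} u \<partial>lborel)"
      by (intro nn_integral_mono) (auto simp: A_def split: split_indicator)
    then show "(\<integral>\<^sup>+u. ennreal ((indicator (A j) u)\<^sup>2) \<partial>lborel) \<le> ennreal (2 * U)"
      using \<open>1 \<le> U\<close> by simp
  qed measurable
  \<comment> \<open>The first term is the error on the window of length 2 U, the second the tail.
    Here n = U^5, and 12 = 3 * 2 * 2 collects the cell factor, 1 + U \<le> 2 U and the window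
    length. The tail, of order U^(-5), is simply bounded by U^(-3).\<close>
  have error: "\<delta> * (2 * U) + C ^ 6 * (2 / (real 5 * (1 + U) ^ 5)) \<le> e\<^sup>2"
  proof -
    have n: "real n = U ^ 5"
      using \<open>1 \<le> n\<close> by (simp add: U_def powr_power)
    have "(real n powr (3 / 10))\<^sup>2 = U ^ 3"
      using \<open>1 \<le> n\<close> by (simp add: U_def powr_power)
    then have e: "e\<^sup>2 = (12 * C + C ^ 6) / U ^ 3"
      using \<open>1 \<le> C\<close> by (simp add: e_def power_divide)
    have "\<delta> * (2 * U) \<le> 3 * (C * (2 * U)) / U ^ 5 * (2 * U)"
      unfolding \<delta>_def Y_def n using \<open>1 \<le> U\<close> \<open>1 \<le> C\<close>
      by (intro mult_right_mono divide_right_mono mult_left_mono) auto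
    also have "\<dots> = 12 * C / U ^ 3"
      using \<open>1 \<le> U\<close> by (simp add: field_simps eval_nat_numeral)
    finally have "\<delta> * (2 * U) \<le> 12 * C / U ^ 3" .
    moreover have "2 / (real 5 * (1 + U) ^ 5) \<le> 1 / U ^ 3"
    proof -
      have "U ^ 3 \<le> (1 + U) ^ 3" using \<open>1 \<le> U\<close> by (intro power_mono) auto
      also have "\<dots> \<le> (1 + U) ^ 5" using \<open>1 \<le> U\<close> by (intro power_increasing) auto
      finally have "2 * U ^ 3 \<le> 5 * (1 + U) ^ 5"
        using zero_le_power[of "1 + U" 5] \<open>1 \<le> U\<close> by linarith
      then show ?thesis using \<open>1 \<le> U\<close> by (simp add: field_simps)
    qed
    then have "C ^ 6 * (2 / (real 5 * (1 + U) ^ 5)) \<le> C ^ 6 * (1 / U ^ 3)"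
      using \<open>1 \<le> C\<close> by (intro mult_left_mono) auto
    ultimately show ?thesis by (simp add: e add_divide_distrib)
  qed
  have "\<exists>g\<in>span ((\<lambda>j. to_L2 (indicator (A j))) ` {..<n}). norm (to_L2 (\<lambda>u. f (X u)) - g) \<le> e"
    if f: "f \<in> K_set" for f
  proof -
    \<comment> \<open>On each cell f(X u) is replaced by the value of \<open>f\<close> at the left
      endpoint -Y + j \<delta>.\<close>
    define h where "h u = (\<Sum>j<n. f (- Y + j * \<delta>) * indicator (A j) u)" for u
    have h_L2: "h \<in> L2_functions"
      unfolding h_def[abs_def] by (rule L2_functions_sum) (rule A_L2)
    have h_span: "to_L2 h \<in> span ((\<lambda>j. to_L2 (indicator (A j))) ` {..<n})"
      unfolding h_def[abs_def] by (rule to_L2_sum_in_span) (rule A_L2)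
    have fX: "(\<lambda>u. f (X u)) \<in> L2_functions"
      using f X \<open>1 \<le> C\<close> low by (intro composition_in_L2[where C = C]) auto
    \<comment> \<open>Inside the window the one-half Hoelder bound makes the squared error at most
      \<delta>; outside it \<open>h\<close> vanishes and the decay of the composition
      remains.\<close>
    have "ennreal ((f (X u) - h u)\<^sup>2) \<le> ennreal \<delta> * indicator {- U..U} u
        + ennreal (C ^ 6) * (ennreal (1 / (1 + \<bar>u\<bar>) ^ Suc 5) * indicator {u. U \<le> \<bar>u\<bar>} u)" for u
    proof (cases "\<bar>u\<bar> \<le> U")
      case True
      then have "h u = (\<Sum>j<n. if j = cell u then f (- Y + j * \<delta>) else 0)"
        unfolding h_def by (intro sum.cong) (auto simp: A_def)
      then have "h u = f (- Y + cell u * \<delta>)"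
        using cell(1)[OF True] by simp
      then have "(f (X u) - h u)\<^sup>2 \<le> \<delta>"
        using K_set_holder[OF f, of "X u" "- Y + cell u * \<delta>"] cell(2)[OF True] by simp
      then have "ennreal ((f (X u) - h u)\<^sup>2) \<le> ennreal \<delta> * indicator {- U..U} u"
        using True by (auto simp: ennreal_leI abs_le_iff)
      then show ?thesis by (rule order_trans) simp
    next
      case False
      then have "h u = 0" by (simp add: h_def A_def)
      moreover have "ennreal ((f (X u))\<^sup>2) \<le> ennreal (C ^ 6 * (1 / (1 + \<bar>u\<bar>) ^ Suc 5))"
        using f \<open>1 \<le> C\<close> low by (intro ennreal_leI composition_decay) auto
      ultimately show ?thesis
        using False \<open>1 \<le> C\<close> by (auto simp: ennreal_mult[symmetric] intro!: add_increasing ennreal_leI)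
    qed
    then have "(\<integral>\<^sup>+u. ennreal ((f (X u) - h u)\<^sup>2) \<partial>lborel)
        \<le> (\<integral>\<^sup>+u. ennreal \<delta> * indicator {- U..U} u
          + ennreal (C ^ 6) * (ennreal (1 / (1 + \<bar>u\<bar>) ^ Suc 5) * indicator {u. U \<le> \<bar>u\<bar>} u) \<partial>lborel)"
      by (intro nn_integral_mono)
    also have "\<dots> = ennreal \<delta> * ennreal (2 * U)
        + ennreal (C ^ 6) * (\<integral>\<^sup>+u. ennreal (1 / (1 + \<bar>u\<bar>) ^ Suc 5) * indicator {u. U \<le> \<bar>u\<bar>} u \<partial>lborel)"
      using \<open>1 \<le> U\<close> by (subst nn_integral_add) (auto simp: nn_integral_cmult simp del: power_Suc)
    also have "\<dots> \<le> ennreal \<delta> * ennreal (2 * U) + ennreal (C ^ 6) * ennreal (2 / (real 5 * (1 + U) ^ 5))"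
      using \<open>1 \<le> U\<close> by (intro add_left_mono mult_left_mono nn_integral_power_tail) auto
    also have "\<dots> = ennreal (\<delta> * (2 * U) + C ^ 6 * (2 / (real 5 * (1 + U) ^ 5)))"
      using \<open>1 \<le> U\<close> \<open>1 \<le> C\<close> \<open>0 < \<delta>\<close>
      by (simp add: ennreal_mult[symmetric] ennreal_plus[symmetric] del: ennreal_plus)
    also have "\<dots> \<le> ennreal (e\<^sup>2)" using error by (rule ennreal_leI)
    finally have "norm (to_L2 (\<lambda>u. f (X u) - h u)) \<le> e"
      using fX h_L2 \<open>1 \<le> C\<close> by (intro norm_to_L2_le L2_functions_diff) (auto simp: e_def)
    then show ?thesis
      using h_span fX h_L2 by (auto simp: to_L2_diff)
  qed
  then show ?thesis
    unfolding e_def[symmetric]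
    by (intro kolmogorov_width_le[where B = "(\<lambda>j. to_L2 (indicator (A j))) ` {..<n}"])
       (auto intro: order_trans[OF card_image_le])
qed

section \<open>Linear growth of the flow\<close>

text \<open>For large |u|, monotonicity squeezes X u between its values at two consecutive integers,
  where X is off by at most half. The bounded central range only enlarges the constant.\<close>

lemma mono_linear_growth:
  fixes X :: "real \<Rightarrow> real"
  assumes "mono X"
    and "\<forall>\<^sub>F n in sequentially. \<bar>X (real n) - real n\<bar> \<le> real n / 2"
    and "\<forall>\<^sub>F n in sequentially. \<bar>X (- real n) + real n\<bar> \<le> real n / 2"
  shows "\<exists>C\<ge>1. \<forall>u. \<bar>X u\<bar> \<le> C * (1 + \<bar>u\<bar>) \<and> 1 + \<bar>u\<bar> \<le> C * (1 + \<bar>X u\<bar>)"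
proof -
  obtain N where "\<forall>n\<ge>N. \<bar>X (real n) - real n\<bar> \<le> real n / 2 \<and> \<bar>X (- real n) + real n\<bar> \<le> real n / 2"
    using eventually_conj[OF assms(2,3)] unfolding eventually_sequentially by blast
  then have N: "\<bar>X (real n) - real n\<bar> \<le> real n / 2" "\<bar>X (- real n) + real n\<bar> \<le> real n / 2"
    if "N \<le> n" for n
    using that by blast+
  have right: "real n / 2 \<le> X (real n)" "X (real n) \<le> 3 / 2 * real n"
    and left: "- (3 / 2 * real n) \<le> X (- real n)" "X (- real n) \<le> - (real n / 2)" if "N \<le> n" for n
    using N[OF that] unfolding abs_le_iff by linarith+
  have mono: "X a \<le> X b" if "a \<le> b" for a b
    using \<open>mono X\<close> that by (rule monoD)
  \<comment> \<open>The summand 2 N covers the central range, and D \<ge> 2 absorbs the slope 2 and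
    the additive constants of the outer range.\<close>
  define D where "D = 2 + 2 * real N"
  have near: "\<bar>X u\<bar> \<le> 2 * real N" if "\<bar>u\<bar> \<le> real N" for u
  proof -
    have "X u \<le> X (real N)" "X (- real N) \<le> X u"
      using that by (auto intro!: mono)
    then show ?thesis using right[of N] left[of N] by (simp add: abs_le_iff)
  qed
  have far: "\<bar>X u\<bar> \<le> 2 * \<bar>u\<bar> + 2" "\<bar>u\<bar> \<le> 2 * \<bar>X u\<bar> + 1" if "real N < \<bar>u\<bar>" for u
  proof -
    \<comment> \<open>Since |u| > N, this floor is still at least \<open>N\<close>, so the integer
      bounds hold at \<open>n\<close> and at \<open>Suc n\<close>.\<close>
    define n where "n = nat \<lfloor>\<bar>u\<bar>\<rfloor>"
    have "real n = \<lfloor>\<bar>u\<bar>\<rfloor>" by (simp add: n_def)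
    then have n: "real n \<le> \<bar>u\<bar>" "\<bar>u\<bar> \<le> real (Suc n)" by linarith+
    have "N \<le> n" using that by (simp add: n_def le_nat_floor)
    have "\<bar>X u\<bar> \<le> 2 * \<bar>u\<bar> + 2 \<and> \<bar>u\<bar> \<le> 2 * \<bar>X u\<bar> + 1"
    proof (cases "0 \<le> u")
      case True
      then have "X (real n) \<le> X u" "X u \<le> X (real (Suc n))"
        using n by (auto intro!: mono)
      then show ?thesis
        using right[OF \<open>N \<le> n\<close>] right[OF le_SucI[OF \<open>N \<le> n\<close>]] n True
        by (auto simp: abs_le_iff abs_if)
    next
      case False
      then have "X u \<le> X (- real n)" "X (- real (Suc n)) \<le> X u"
        using n by (auto intro!: mono)
      then have "X u \<le> - (real n / 2)" "- (3 / 2 * real (Suc n)) \<le> X u"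
        using left(2)[OF \<open>N \<le> n\<close>] left(1)[OF le_SucI[OF \<open>N \<le> n\<close>]]
        by (blast intro: order_trans)+
      moreover from this(2) have "- X u \<le> 3 / 2 * real n + 3 / 2"
        by (simp add: distrib_left)
      moreover have "\<bar>u\<bar> = - u" "\<bar>X u\<bar> = - X u"
        using False calculation(1) by auto
      moreover have "real n \<le> - u" "- u \<le> real (Suc n)" "0 \<le> - u"
        using n False by auto
      ultimately show ?thesis by (intro conjI; linarith)
    qed
    then show "\<bar>X u\<bar> \<le> 2 * \<bar>u\<bar> + 2" "\<bar>u\<bar> \<le> 2 * \<bar>X u\<bar> + 1"
      by blast+
  qed
  have "\<bar>X u\<bar> \<le> D * (1 + \<bar>u\<bar>) \<and> 1 + \<bar>u\<bar> \<le> D * (1 + \<bar>X u\<bar>)" for u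
  proof -
    have D: "D + 2 * \<bar>y\<bar> \<le> D * (1 + \<bar>y\<bar>)" for y :: real
    proof -
      have "2 * \<bar>y\<bar> \<le> D * \<bar>y\<bar>"
        by (rule mult_right_mono) (simp_all add: D_def)
      then show ?thesis by (simp only: distrib_left mult_1_right add_left_mono)
    qed
    have "\<bar>X u\<bar> \<le> D + 2 * \<bar>u\<bar> \<and> 1 + \<bar>u\<bar> \<le> D + 2 * \<bar>X u\<bar>"
    proof (cases "\<bar>u\<bar> \<le> real N")
      case True
      then show ?thesis
        using near[OF True] abs_ge_zero[of u] abs_ge_zero[of "X u"] unfolding D_def
        by (intro conjI; linarith)
    next
      case False
      then have "real N < \<bar>u\<bar>" by simp
      from far[OF this] show ?thesis unfolding D_def by (intro conjI; linarith)
    qed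
    then show ?thesis using D[of u] D[of "X u"] by linarith
  qed
  moreover have "1 \<le> D" by (simp add: D_def)
  ultimately show ?thesis by blast
qed

section \<open>Almost sure control at countably many starting points\<close>

context prob_space
begin

text \<open>Chebyshev bounds the n-th deviation probability by 4 \<sigma>^2 / n^2, which is
  summable. The first Borel-Cantelli lemma asks for nothing more, which suits the dependent paths of
  a flow.\<close>

lemma normal_deviation_AE_eventually:
  fixes Z :: "nat \<Rightarrow> 'a \<Rightarrow> real"
  assumes "0 < \<sigma>" and Z: "\<And>n. distributed M lborel (Z n) (normal_density 0 \<sigma>)"
  shows "AE \<omega> in M. \<forall>\<^sub>F n in sequentially. \<bar>Z n \<omega>\<bar> \<le> real n / 2"
proof -
  have [measurable]: "random_variable borel (Z n)" for n
    using distributed_measurable[OF Z] by simp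
  \<comment> \<open>The shift by one keeps the Chebyshev threshold positive.\<close>
  define A where "A n = {\<omega> \<in> space M. real (Suc n) / 2 \<le> \<bar>Z (Suc n) \<omega>\<bar>}" for n
  have [measurable]: "A n \<in> events" for n
    unfolding A_def by measurable
  have "prob (A n) \<le> 4 * \<sigma>\<^sup>2 * inverse (real (Suc n) ^ 2)" for n
  proof -
    have E: "expectation (Z (Suc n)) = 0" "variance (Z (Suc n)) = \<sigma>\<^sup>2"
      using normal_distributed_expectation[OF \<open>0 < \<sigma>\<close> Z] normal_distributed_variance[OF \<open>0 < \<sigma>\<close> Z] by auto
    \<comment> \<open>The Bochner integral of a non-integrable function is 0 by convention, so the
      nonzero second moment proves integrability.\<close>
    then have "expectation (\<lambda>\<omega>. (Z (Suc n) \<omega>)\<^sup>2) \<noteq> 0"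
      using \<open>0 < \<sigma>\<close> by simp
    then have "integrable M (\<lambda>\<omega>. (Z (Suc n) \<omega>)\<^sup>2)"
      using not_integrable_integral_eq by blast
    then have "prob (A n) \<le> variance (Z (Suc n)) / (real (Suc n) / 2)\<^sup>2"
      using Chebyshev_inequality[of "Z (Suc n)" "real (Suc n) / 2"] E(1) by (simp add: A_def)
    then show ?thesis
      unfolding E(2) by (simp add: field_simps)
  qed
  then have bound: "norm (prob (A n)) \<le> 4 * \<sigma>\<^sup>2 * inverse (real (Suc n) ^ 2)" for n
    by simp
  have "summable (\<lambda>n. 4 * \<sigma>\<^sup>2 * inverse (real (Suc n) ^ 2))"
    using inverse_power_summable[of 2, where 'a = real]
    by (intro summable_mult) (subst summable_Suc_iff, simp)
  then have "summable (\<lambda>n. prob (A n))"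
    by (rule summable_comparison_test'[where N = 0]) (rule bound)
  then have "AE \<omega> in M. \<forall>\<^sub>F n in sequentially. \<omega> \<in> space M - A n"
    by (rule borel_cantelli_AE1[rotated 2]) (simp_all add: emeasure_eq_measure)
  then show ?thesis
  proof (rule AE_mp, intro AE_I2 impI)
    fix \<omega> assume "\<forall>\<^sub>F n in sequentially. \<omega> \<in> space M - A n"
    then have "\<forall>\<^sub>F n in sequentially. \<bar>Z (Suc n) \<omega>\<bar> \<le> real (Suc n) / 2"
      by eventually_elim (auto simp: A_def)
    then show "\<forall>\<^sub>F n in sequentially. \<bar>Z n \<omega>\<bar> \<le> real n / 2"
      by (subst (asm) eventually_sequentially_Suc)
  qed
qed

end

context arratia_flow
begin

text \<open>The increment over [0, t] is centred normal with variance t for every starting point. As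
  x(v, 0) = v holds only almost surely, countably many null sets are merged.\<close>

lemma deviation_AE_eventually:
  fixes v :: "nat \<Rightarrow> real"
  assumes "0 < t"
  shows "AE \<omega> in M. \<forall>\<^sub>F n in sequentially. \<bar>x (v n) t \<omega> - v n\<bar> \<le> real n / 2"
proof -
  have "AE \<omega> in M. \<forall>\<^sub>F n in sequentially. \<bar>x (v n) t \<omega> - x (v n) 0 \<omega>\<bar> \<le> real n / 2"
  proof (rule normal_deviation_AE_eventually)
    show "distributed M lborel (\<lambda>\<omega>. x (v n) t \<omega> - x (v n) 0 \<omega>) (normal_density 0 (sqrt t))" for n
    proof -
      have "\<forall>r s. 0 \<le> r \<and> r < s \<longrightarrow> distributed M lborel (\<lambda>\<omega>. x (v n) s \<omega> - x (v n) r \<omega>)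
          (normal_density 0 (sqrt (s - r)))"
        using wiener[of "v n"] by (simp add: wiener_process_def)
      from this[rule_format, of 0 t] show ?thesis using \<open>0 < t\<close> by simp
    qed
  qed (use \<open>0 < t\<close> in simp)
  moreover have "AE \<omega> in M. \<forall>n. x (v n) 0 \<omega> = v n"
    unfolding AE_all_countable using wiener by (simp add: wiener_process_def)
  ultimately show ?thesis by eventually_elim simp
qed

end

lemma (in right_continuous_arratia_flow) linear_growth_AE:
  assumes "0 < t"
  shows "AE \<omega> in M. mono (\<lambda>u. x u t \<omega>) \<and>
    (\<exists>C\<ge>1. \<forall>u. \<bar>x u t \<omega>\<bar> \<le> C * (1 + \<bar>u\<bar>) \<and> 1 + \<bar>u\<bar> \<le> C * (1 + \<bar>x u t \<omega>\<bar>))"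
  using right_continuous_step[OF assms]
    deviation_AE_eventually[OF assms, of real] deviation_AE_eventually[OF assms, of "\<lambda>n. - real n"]
proof eventually_elim
  case (elim \<omega>)
  then show ?case using mono_linear_growth[of "\<lambda>u. x u t \<omega>"] by simp
qed

theorem theorem3p3:
  fixes M :: "'w measure" and x :: "real \<Rightarrow> real \<Rightarrow> 'w \<Rightarrow> real" and t :: real
  assumes "t > 0"
    and "right_continuous_arratia_flow M x"
  shows "\<exists>\<Omega>' \<in> sets M. measure M \<Omega>' = 1 \<and>
    (\<exists>C :: 'w \<Rightarrow> real. \<forall>\<omega>\<in>\<Omega>'.
       C \<omega> > 0 \<and>
       flow_operator x t \<omega> ` K_set \<subseteq> L2_functions \<and>
       (\<forall>n::nat. n \<ge> 1 \<longrightarrow>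
          kolmogorov_width n (to_L2 ` flow_operator x t \<omega> ` K_set)
            \<le> ennreal (C \<omega> / real n powr (3 / 10))))"
proof -
  interpret right_continuous_arratia_flow M x by fact
  define good where "good \<omega> C \<longleftrightarrow> 1 \<le> C \<and>
      (\<forall>u. \<bar>x u t \<omega>\<bar> \<le> C * (1 + \<bar>u\<bar>) \<and> 1 + \<bar>u\<bar> \<le> C * (1 + \<bar>x u t \<omega>\<bar>))" for \<omega> C
  from linear_growth_AE[OF \<open>t > 0\<close>] have "AE \<omega> in M. mono (\<lambda>u. x u t \<omega>) \<and> (\<exists>C. good \<omega> C)"
    by (simp add: good_def)
  \<comment> \<open>Measurability of the set of good \<omega> is not evident, because of the
    quantifiers over reals; the complement of a null set is taken as \<open>\<Omega>'\<close>
    instead.\<close>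
  then obtain N where N: "N \<in> null_sets M"
      and out: "\<And>\<omega>. \<omega> \<in> space M - N \<Longrightarrow> mono (\<lambda>u. x u t \<omega>) \<and> (\<exists>C. good \<omega> C)"
    by (rule AE_E3) blast
  \<comment> \<open>The growth constant is chosen separately for each \<omega>; from here on the
    argument is deterministic.\<close>
  define c where "c \<omega> = (SOME C. good \<omega> C)" for \<omega>
  define C where "C \<omega> = sqrt (12 * c \<omega> + c \<omega> ^ 6)" for \<omega>
  have good: "good \<omega> (c \<omega>)" "(\<lambda>u. x u t \<omega>) \<in> borel_measurable borel" if "\<omega> \<in> space M - N" for \<omega>
    using out[OF that] unfolding c_def by (auto intro: someI_ex borel_measurable_mono)
  have flow: "flow_operator x t \<omega> = (\<lambda>f u. f (x u t \<omega>))" for \<omega>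
    by (simp add: flow_operator_def fun_eq_iff)
  show ?thesis
  proof (intro bexI[of _ "space M - N"] conjI exI[of _ C] ballI allI impI)
    show "measure M (space M - N) = 1"
      using N by (subst prob_compl) (auto simp: null_sets_def measure_def)
    show "space M - N \<in> sets M" using N by auto
    fix \<omega> assume \<omega>: "\<omega> \<in> space M - N"
    then have "1 \<le> c \<omega>" using good(1) by (simp add: good_def)
    then show "0 < C \<omega>" by (simp add: C_def add_pos_nonneg)
    show "flow_operator x t \<omega> ` K_set \<subseteq> L2_functions"
      using good[OF \<omega>] unfolding flow good_def
      by (auto intro!: composition_in_L2[where C = "c \<omega>" and X = "\<lambda>u. x u t \<omega>"])
    fix n :: nat assume "1 \<le> n"
    then show "kolmogorov_width n (to_L2 ` flow_operator x t \<omega> ` K_set)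
        \<le> ennreal (C \<omega> / real n powr (3 / 10))"
      using good[OF \<omega>] unfolding flow good_def C_def
      by (intro kolmogorov_width_composition) auto
  qed
qed

end
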